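(* Let $(X,\ast)$ be a commutative quandle. Then $X$ is cocommutative if and only if $X$ is a kei.
   Context: A magma $(X,\ast)$ is a set with a binary operation. For $x\in X$, let $R_x\colon X\to X$ be $y\mapsto y\ast x$. A rack is a magma in which every $R_x$ is an automorphism of the magma (a bijective map preserving $\ast$). A quandle is a rack with $x\ast x=x$ for all $x$. A kei is a quandle such that every $R_x$ is an involution, i.e. $R_x\circ R_x=\mathrm{id}_X$. A magma is commutative if $x\ast y=y\ast x$ for all $x,y$. The dual rack of a rack $(X,\ast)$ is $X^{\mathrm{op}}:=(X,\overline{\ast})$ with $x\mathbin{\overline{\ast}}y:=R_y^{-1}(x)$; it is again a rack. A rack $X$ is cocommutative if $X^{\mathrm{op}}$ is commutative. *)

theory Defs
  imports Main
begin

text \<open>A magma is given by a carrier set \<open>X\<close>, possibly empty, together with an operation on the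
  ambient type; only the values of the operation on \<open>X\<close> matter.\<close>

definition magma :: "'a set \<Rightarrow> ('a \<Rightarrow> 'a \<Rightarrow> 'a) \<Rightarrow> bool" where
  "magma X op \<longleftrightarrow> (\<forall>x\<in>X. \<forall>y\<in>X. op x y \<in> X)"

definition commutative_magma :: "'a set \<Rightarrow> ('a \<Rightarrow> 'a \<Rightarrow> 'a) \<Rightarrow> bool" where
  "commutative_magma X op \<longleftrightarrow> magma X op \<and> (\<forall>x\<in>X. \<forall>y\<in>X. op x y = op y x)"

definition right_mult :: "('a \<Rightarrow> 'a \<Rightarrow> 'a) \<Rightarrow> 'a \<Rightarrow> 'a \<Rightarrow> 'a" where
  "right_mult op x = (\<lambda>y. op y x)"

definition magma_automorphism :: "'a set \<Rightarrow> ('a \<Rightarrow> 'a \<Rightarrow> 'a) \<Rightarrow> ('a \<Rightarrow> 'a) \<Rightarrow> bool" where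
  "magma_automorphism X op f \<longleftrightarrow>
     bij_betw f X X \<and> (\<forall>y\<in>X. \<forall>z\<in>X. f (op y z) = op (f y) (f z))"

definition rack :: "'a set \<Rightarrow> ('a \<Rightarrow> 'a \<Rightarrow> 'a) \<Rightarrow> bool" where
  "rack X op \<longleftrightarrow> magma X op \<and> (\<forall>x\<in>X. magma_automorphism X op (right_mult op x))"

definition quandle :: "'a set \<Rightarrow> ('a \<Rightarrow> 'a \<Rightarrow> 'a) \<Rightarrow> bool" where
  "quandle X op \<longleftrightarrow> rack X op \<and> (\<forall>x\<in>X. op x x = x)"

definition kei :: "'a set \<Rightarrow> ('a \<Rightarrow> 'a \<Rightarrow> 'a) \<Rightarrow> bool" where
  "kei X op \<longleftrightarrow>
     quandle X op \<and> (\<forall>x\<in>X. \<forall>y\<in>X. (right_mult op x \<circ> right_mult op x) y = y)"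

text \<open>The operation of the dual rack, with the inverse of the right multiplication by \<open>y\<close> taken
  as a map on the carrier \<open>X\<close>.\<close>

definition dual_op :: "'a set \<Rightarrow> ('a \<Rightarrow> 'a \<Rightarrow> 'a) \<Rightarrow> 'a \<Rightarrow> 'a \<Rightarrow> 'a" where
  "dual_op X op x y = inv_into X (right_mult op y) x"

definition cocommutative_rack :: "'a set \<Rightarrow> ('a \<Rightarrow> 'a \<Rightarrow> 'a) \<Rightarrow> bool" where
  "cocommutative_rack X op \<longleftrightarrow> rack X op \<and> commutative_magma X (dual_op X op)"

end

theory Submission
  imports Defs
begin

text \<open>Write \<open>x / y\<close> for the dual product \<open>R\<^sub>y\<^sup>-\<^sup>1(x)\<close>. If \<open>X\<close> is a kei, each \<open>R\<^sub>y\<close> is its own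
  inverse, so the dual product is the original one and inherits its commutativity.
  Conversely, put \<open>x = z * y\<close>, that is, \<open>z = x / y\<close>. Cocommutativity gives \<open>z = y / x\<close>, so
  \<open>z * x = y\<close>. Together, \<open>z * (z * y) = y\<close>: left multiplication by \<open>z\<close> is an involution, and
  commutativity turns left multiplications into right ones.\<close>

lemma rack_op_closed:
  assumes "rack X op" "x \<in> X" "y \<in> X"
  shows "op x y \<in> X"
  using assms by (simp add: rack_def magma_def)

lemma rack_right_mult_bij:
  assumes "rack X op" "y \<in> X"
  shows "bij_betw (right_mult op y) X X"
  using assms by (simp add: rack_def magma_automorphism_def)

lemma rack_dual_op_cancel:
  assumes "rack X op" "x \<in> X" "y \<in> X"
  shows "op (dual_op X op x y) y = x"
  using bij_betw_inv_into_right[OF rack_right_mult_bij[OF assms(1,3)] assms(2)]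
  by (simp add: dual_op_def right_mult_def)

lemma rack_dual_op_eqI:
  assumes "rack X op" "y \<in> X" "z \<in> X" "op z y = x"
  shows "dual_op X op x y = z"
  using bij_betw_inv_into_left[OF rack_right_mult_bij[OF assms(1,2)] assms(3)] assms(4)
  by (simp add: dual_op_def right_mult_def)

lemma kei_dual_op_eq:
  assumes "kei X op" "x \<in> X" "y \<in> X"
  shows "dual_op X op x y = op x y"
proof (rule rack_dual_op_eqI)
  show "rack X op"
    using assms(1) by (simp add: kei_def quandle_def)
  then show "op x y \<in> X"
    using assms(2,3) by (rule rack_op_closed)
  show "op (op x y) y = x"
    using assms by (simp add: kei_def right_mult_def)
qed (rule assms(3))

text \<open>Both \<open>R\<^sub>y\<^sup>-\<^sup>1(z * y)\<close> and \<open>R\<^bsub>z * y\<^esub>\<^sup>-\<^sup>1(y)\<close> are \<open>z\<close>: the first because right multiplication by \<open>y\<close>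
  is injective, the second by cocommutativity. Applying \<open>R\<^bsub>z * y\<^esub>\<close> to the second expression
  returns \<open>y\<close>.\<close>

lemma cocommutative_rack_left_involution:
  assumes "cocommutative_rack X op" "y \<in> X" "z \<in> X"
  shows "op z (op z y) = y"
proof -
  have rack: "rack X op"
    using assms(1) by (simp add: cocommutative_rack_def)
  have x: "op z y \<in> X"
    using rack assms(3,2) by (rule rack_op_closed)
  have "z = dual_op X op (op z y) y"
    using rack_dual_op_eqI[OF rack assms(2,3) refl] by simp
  also have "\<dots> = dual_op X op y (op z y)"
    using assms(1,2) x by (simp add: cocommutative_rack_def commutative_magma_def)
  finally show ?thesis
    using rack_dual_op_cancel[OF rack assms(2) x] by simp
qed

theorem corollary3p3:
  fixes X :: "'a set" and op :: "'a \<Rightarrow> 'a \<Rightarrow> 'a"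
  assumes "quandle X op" and "commutative_magma X op"
  shows "cocommutative_rack X op \<longleftrightarrow> kei X op"
proof
  have rack: "rack X op"
    using assms(1) by (simp add: quandle_def)
  have comm: "op x y = op y x" if "x \<in> X" "y \<in> X" for x y
    using assms(2) that by (simp add: commutative_magma_def)
  {
    assume cocomm: "cocommutative_rack X op"
    have "op (op y z) z = y" if "y \<in> X" "z \<in> X" for y z
    proof -
      have "op (op y z) z = op z (op y z)"
        using rack_op_closed[OF rack that] that(2) by (rule comm)
      also have "\<dots> = op z (op z y)"
        using comm[OF that] by simp
      also have "\<dots> = y"
        using cocomm that by (rule cocommutative_rack_left_involution)
      finally show ?thesis .
    qed
    then show "kei X op"
      using assms(1) by (simp add: kei_def right_mult_def)
  next
    assume "kei X op"
    then show "cocommutative_rack X op"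
      using rack assms(2)
      by (simp add: cocommutative_rack_def commutative_magma_def magma_def kei_dual_op_eq)
  }
qed

end
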